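(* Under the standing setup below (in either the constant or the nonconstant case), if $n\le\frac{t-1}{2}$ and $q>(6n d_1)^{\frac{2t+2}{t-2n}}$, then the system $\sum_{i=1}^t a_{ji}X_i^{d_i}=g_j(X_1,\dots,X_k)$, $1\le j\le n$, has at least one solution in $\mathbb F_q^t$.
   Context: Standing setup: $\mathbb F_q$ is a finite field with $q$ elements. Let $t,n,k$ be positive integers with $1\le k\le n$, and let $d_1>d_2>\cdots>d_t\ge 2$ be integers none divisible by the characteristic of $\mathbb F_q$. Let $A=(a_{ji})\in\mathbb F_q^{n\times t}$ satisfy hypothesis (H): every $n\times n$ submatrix of $A$ (formed by any choice of $n$ columns) has rank $n$. Let $g_1,\dots,g_n\in\mathbb F_q[X_1,\dots,X_k]$ be such that either (constant case) $g_j\in\mathbb F_q$ for all $j$, or (nonconstant case) $0\le\deg g_j<d_t$ for all $j$ and $\deg g_i>0$ for some $i$. *)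

theory Defs
  imports Complex_Main "HOL-Library.Poly_Mapping" "Jordan_Normal_Form.DL_Rank_Submatrix"
begin

text \<open>Multivariate polynomials over a commutative ring, represented as finitely supported
  maps from monomials (finitely supported exponent vectors, variable X_(i+1) has index i)
  to coefficients.\<close>

type_synonym 'a mpoly_rep = "(nat \<Rightarrow>\<^sub>0 nat) \<Rightarrow>\<^sub>0 'a"

definition mp_vars_below :: "nat \<Rightarrow> ('a::zero) mpoly_rep \<Rightarrow> bool" where
  "mp_vars_below k p \<longleftrightarrow> (\<forall>m \<in> Poly_Mapping.keys p. Poly_Mapping.keys m \<subseteq> {0..<k})"

definition mp_totdeg :: "('a::zero) mpoly_rep \<Rightarrow> nat" where
  "mp_totdeg p = Max (insert 0 ((\<lambda>m. sum (Poly_Mapping.lookup m) (Poly_Mapping.keys m)) ` Poly_Mapping.keys p))"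

definition mp_eval :: "('a::comm_semiring_1) mpoly_rep \<Rightarrow> (nat \<Rightarrow> 'a) \<Rightarrow> 'a" where
  "mp_eval p x = (\<Sum>m \<in> Poly_Mapping.keys p. Poly_Mapping.lookup p m * (\<Prod>i \<in> Poly_Mapping.keys m. x i ^ Poly_Mapping.lookup m i))"

end

theory Submission
  imports Defs "HOL-Analysis.Convex" "HOL-Number_Theory.Cong" "HOL-Library.Cardinality"
begin

text \<open>
  Put \<open>u(c) = c A\<close> for \<open>c \<in> \<bbbF>\<^sub>q\<^sup>n\<close> and let \<open>\<psi>\<close> be a nontrivial additive character.  If there is no
  solution, then summing \<open>\<psi>\<close> over all \<open>c\<close> and all points gives \<open>\<Sum>\<^sub>c T(c) \<Prod>\<^sub>i\<^sub>>\<^sub>k G\<^sub>i(u\<^sub>i(c)) = 0\<close>,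
  where \<open>G\<^sub>i\<close> is a one-variable power sum and \<open>T(c)\<close> is the exponential sum over the variables
  \<open>X\<^sub>1, \<dots>, X\<^sub>k\<close> that also occur in the \<open>g\<^sub>j\<close>.  The term \<open>c = 0\<close> is \<open>q\<^sup>t\<close>; the others are bounded by
  Cauchy--Schwarz, so that no estimate for the individual \<open>T(c)\<close> is needed.  By orthogonality
  \<open>\<Sum>\<^sub>c |T(c)|\<^sup>2\<close> counts coincidences of a map \<open>\<bbbF>\<^sub>q\<^sup>k \<rightarrow> \<bbbF>\<^sub>q\<^sup>n\<close> whose fibres have at most \<open>d\<^sub>1 \<cdots> d\<^sub>k\<close>
  points, because \<open>deg g\<^sub>j < d\<^sub>i\<close>.  For \<open>u \<noteq> 0\<close> one has \<open>|G\<^sub>i(u)|\<^sup>2 \<le> 2 d\<^sub>i\<^sup>2 q\<close>, and by (H) some \<open>n\<close> of the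
  columns contain all zeros of \<open>u(c)\<close> while determining \<open>c\<close>; this bounds the other factor.
\<close>

subsection \<open>Additive characters and power sums\<close>

text \<open>A complement of the prime field in the additive group; it assigns to every field element
  a residue modulo the characteristic. Take \<open>H\<close> maximal among additively closed sets
  containing 0 but not 1: adjoining any further \<open>x\<close> must produce 1, and this makes
  \<open>x\<close> congruent modulo \<open>H\<close> to an element of the prime field.\<close>

lemma prime_field_additive_complement:
  obtains H :: "'a::{finite,field} set"
  where "\<And>x y. x \<in> H \<Longrightarrow> y \<in> H \<Longrightarrow> x + y \<in> H" "\<And>x. x \<in> H \<Longrightarrow> - x \<in> H"
    "\<And>j. of_nat j \<in> H \<Longrightarrow> CHAR('a) dvd j" "\<And>x. \<exists>j::nat. x - of_nat j \<in> H"
proof -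
  define p where "p = CHAR('a)"
  have p: "prime p"
    unfolding p_def by (intro prime_CHAR_semidom finite_imp_CHAR_pos) simp
  have inverse_mod_p: "\<exists>j. of_nat i * of_nat j = (1 :: 'a)" if "\<not> p dvd i" for i
  proof -
    have "coprime i p"
      using p that by (metis prime_imp_coprime coprime_commute)
    then obtain j where "[i * j = 1] (mod p)"
      using cong_solve_coprime_nat[of i p] by auto
    then have "of_nat i * of_nat j = (1 :: 'a)"
      using of_nat_eq_iff_cong_CHAR[of "i * j" 1, where 'a = 'a] by (simp add: p_def)
    then show ?thesis ..
  qed
  define \<G> where "\<G> = {H :: 'a set. 0 \<in> H \<and> 1 \<notin> H \<and> (\<forall>x\<in>H. \<forall>y\<in>H. x + y \<in> H)}"
  have "{0} \<in> \<G>" "finite \<G>"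
    by (auto simp: \<G>_def)
  then obtain H where H: "H \<in> \<G>" and max: "\<And>H'. H' \<in> \<G> \<Longrightarrow> H \<subseteq> H' \<Longrightarrow> H = H'"
    using finite_has_maximal[of \<G>] by blast
  have H0: "0 \<in> H" and H1: "1 \<notin> H" and Hadd: "\<And>x y. x \<in> H \<Longrightarrow> y \<in> H \<Longrightarrow> x + y \<in> H"
    using H by (auto simp: \<G>_def)
  have Hmult: "of_nat j * x \<in> H" if "x \<in> H" for j x
    by (induction j) (use that H0 Hadd in \<open>auto simp: distrib_right\<close>)
  have Hneg: "- x \<in> H" if "x \<in> H" for x
  proof -
    \<comment> \<open>Closure under addition already yields negatives, since -1 is the natural
      number \<open>p - 1\<close> in the field.\<close>
    have "of_nat (p - 1) = (-1 :: 'a)"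
      using p prime_gt_0_nat[OF p] by (simp add: of_nat_diff p_def)
    with Hmult[OF that, of "p - 1"] show ?thesis by simp
  qed
  have Hnat: "p dvd j" if "of_nat j \<in> H" for j
    using inverse_mod_p[of j] Hmult[OF that] H1 by (metis mult.commute)
  have "\<exists>j::nat. x - of_nat j \<in> H" for x
  proof (cases "x \<in> H")
    case True
    then show ?thesis by (intro exI[of _ 0]) simp
  next
    case False
    define H' where "H' = {h + of_nat i * x | h i. h \<in> H}"
    have "H \<subseteq> H'" unfolding H'_def by (force intro: exI[of _ "0::nat"])
    moreover have "x \<in> H'" unfolding H'_def
      using H0 by (intro CollectI exI[of _ 0] exI[of _ "1::nat"]) auto
    moreover have "y + z \<in> H'" if yz: "y \<in> H'" "z \<in> H'" for y z
    proof -
      obtain h i h' i' where *: "h \<in> H" "h' \<in> H" "y = h + of_nat i * x" "z = h' + of_nat i' * x"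
        using yz unfolding H'_def by auto
      then show ?thesis unfolding H'_def
        by (intro CollectI exI[of _ "h + h'"] exI[of _ "i + i'"]) (auto intro: Hadd simp: algebra_simps)
    qed
    \<comment> \<open>\<open>H'\<close> is additively closed and strictly larger than
      \<open>H\<close>, so it can only leave \<open>\<G>\<close> by containing 1.\<close>
    ultimately have "1 \<in> H'"
      using max[of H'] H0 False unfolding \<G>_def by blast
    then obtain h i where h: "h \<in> H" "1 = h + of_nat i * x" unfolding H'_def by auto
    have "(of_nat i :: 'a) \<noteq> 0" using h H1 by auto
    then have "\<not> p dvd i" by (simp add: of_nat_eq_0_iff_char_dvd p_def)
    then obtain j where ij: "of_nat i * of_nat j = (1 :: 'a)" using inverse_mod_p by blast
    have "x - of_nat j = of_nat j * (of_nat i * x - 1)"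
      using ij by (simp add: algebra_simps)
    also have "of_nat i * x - 1 = - h" using h by (simp add: algebra_simps)
    finally have "x - of_nat j = of_nat j * - h" .
    with Hmult[OF Hneg[OF h(1)], of j] show ?thesis by (intro exI[of _ j]) simp
  qed
  then show ?thesis using that[of H] Hadd Hneg Hnat unfolding p_def by blast
qed

text \<open>Expanding the square and summing over \<open>c\<close> first leaves only the pairs with
  equal \<open>F\<close>-value, each with weight \<open>Q\<close>; every \<open>x\<close> has at
  most \<open>D\<close> partners. It serves both the one-variable power sums and the sums
  \<open>T(c)\<close>.\<close>

lemma sum_norm_square_orthogonal:
  fixes e :: "'b \<Rightarrow> 'c \<Rightarrow> complex"
  assumes "finite X" and orth: "\<And>x x'. x \<in> X \<Longrightarrow> x' \<in> X \<Longrightarrow>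
      (\<Sum>c\<in>C. e c x * cnj (e c x')) = (if F x = F x' then of_nat Q else 0)"
    and fib: "\<And>x. x \<in> X \<Longrightarrow> card {x' \<in> X. F x' = F x} \<le> D"
  shows "(\<Sum>c\<in>C. (cmod (\<Sum>x\<in>X. e c x))\<^sup>2) \<le> real Q * real (card X) * real D"
proof -
  have "complex_of_real (\<Sum>c\<in>C. (cmod (\<Sum>x\<in>X. e c x))\<^sup>2)
      = (\<Sum>c\<in>C. \<Sum>x\<in>X. \<Sum>x'\<in>X. e c x * cnj (e c x'))"
    by (simp only: of_real_sum complex_norm_square cnj_sum sum_product)
  also have "\<dots> = (\<Sum>x\<in>X. \<Sum>x'\<in>X. \<Sum>c\<in>C. e c x * cnj (e c x'))"
    by (subst sum.swap) (intro sum.cong sum.swap refl)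
  also have "\<dots> = (\<Sum>x\<in>X. \<Sum>x'\<in>X. if F x' = F x then of_nat Q else 0)"
    by (intro sum.cong refl) (auto simp: orth)
  also have "\<dots> = complex_of_real (\<Sum>x\<in>X. real Q * real (card {x' \<in> X. F x' = F x}))"
    by (simp add: sum.If_cases assms(1) Int_def mult.commute)
  finally have "(\<Sum>c\<in>C. (cmod (\<Sum>x\<in>X. e c x))\<^sup>2) = (\<Sum>x\<in>X. real Q * real (card {x' \<in> X. F x' = F x}))"
    by (rule of_real_eq_iff[THEN iffD1])
  also have "\<dots> \<le> (\<Sum>x\<in>X. real Q * real D)"
    by (intro sum_mono mult_left_mono) (use fib in auto)
  finally show ?thesis by (simp add: mult_ac)
qed

lemma card_nth_roots_le:
  fixes v :: "'a::{finite,field}"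
  assumes "m > 0"
  shows "card {y. y ^ m = v} \<le> m"
proof -
  let ?p = "monom 1 m - [:v:]"
  have deg: "degree ?p = m" using assms
    by (intro antisym degree_diff_le le_degree) (auto simp: degree_monom_le coeff_pCons split: nat.split)
  then have "?p \<noteq> 0" using assms by auto
  then have "card {y. poly ?p y = 0} \<le> m" using card_poly_roots_bound[of ?p] deg by simp
  then show ?thesis by (simp add: poly_monom)
qed

text \<open>Nontriviality is demanded at the point 1, so that a shift by \<open>inverse v\<close>
  always produces the factor \<open>\<psi> 1\<close>.\<close>

locale nontrivial_additive_character =
  fixes \<psi> :: "'a::{finite,field} \<Rightarrow> complex"
  assumes add: "\<psi> (x + y) = \<psi> x * \<psi> y"
    and norm_eq_1: "cmod (\<psi> x) = 1"
    and nontrivial: "\<psi> 1 \<noteq> 1"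

text \<open>The projection along \<open>H\<close> onto the prime field is followed by a primitive
  \<open>p\<close>-th root of unity. The chosen representative \<open>J x\<close> is determined only
  modulo \<open>p\<close>, which \<open>e\<close> does not see.\<close>

lemma nontrivial_additive_character_exists:
  obtains \<psi> :: "'a::{finite,field} \<Rightarrow> complex"
  where "nontrivial_additive_character \<psi>"
proof -
  define p where "p = CHAR('a)"
  have p: "prime p"
    unfolding p_def by (intro prime_CHAR_semidom finite_imp_CHAR_pos) simp
  obtain H :: "'a set" where Hadd: "\<And>x y. x \<in> H \<Longrightarrow> y \<in> H \<Longrightarrow> x + y \<in> H"
    and neg: "\<And>x. x \<in> H \<Longrightarrow> - x \<in> H" and Hnat: "\<And>j. of_nat j \<in> H \<Longrightarrow> p dvd j"
    and ex: "\<And>x. \<exists>j::nat. x - of_nat j \<in> H"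
    unfolding p_def using prime_field_additive_complement by blast
  define J where "J x = (SOME j::nat. x - of_nat j \<in> H)" for x
  have J: "x - of_nat (J x) \<in> H" for x
    unfolding J_def using ex by (rule someI_ex)
  define e where "e j = cis (2 * pi * real j / real p)" for j :: nat
  have e_add: "e (i + j) = e i * e j" for i j
    by (simp add: e_def cis_mult add_divide_distrib distrib_left)
  have e_1: "e j = 1 \<longleftrightarrow> p dvd j" for j
  proof
    assume "p dvd j"
    then obtain r where "j = p * r" by auto
    then have "2 * pi * real j / real p = 2 * pi * real r"
      using prime_gt_0_nat[OF p] by simp
    then show "e j = 1" unfolding e_def by (metis cis_multiple_2pi Ints_of_nat)
  next
    assume "e j = 1"
    then have "cos (2 * pi * real j / real p) = 1" unfolding e_def by (simp add: complex_eq_iff)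
    then obtain r :: int where "2 * pi * real j / real p = of_int r * 2 * pi"
      using cos_one_2pi_int by blast
    then have "real j = real_of_int r * real p"
      using prime_gt_0_nat[OF p] by (simp add: field_simps)
    then have "int j = r * int p" by (metis of_int_eq_iff of_int_mult of_int_of_nat_eq)
    then show "p dvd j" by (metis dvd_triv_right int_dvd_int_iff)
  qed
  have e_eq: "e i = e j" if "of_nat i - of_nat j \<in> H" for i j
  proof -
    \<comment> \<open>Adding \<open>j * (p - 1)\<close> stands for subtracting \<open>j\<close>,
      which avoids truncated subtraction of naturals.\<close>
    have "of_nat (i + j * (p - 1)) = (of_nat i - of_nat j :: 'a)"
      using p prime_gt_0_nat[OF p] by (simp add: of_nat_diff p_def)
    then have "p dvd i + j * (p - 1)" using that Hnat by metis
    then have "e (i + j * (p - 1)) = 1" using e_1 by blast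
    moreover have "e (j + j * (p - 1)) = 1"
      using e_1 prime_gt_0_nat[OF p]
      by (metis Suc_diff_1 dvd_triv_right mult_Suc_right)
    moreover have "e (j * (p - 1)) \<noteq> 0" by (simp add: e_def)
    ultimately show ?thesis by (metis e_add mult_right_cancel)
  qed
  show ?thesis
  proof (rule that[of "\<lambda>x. e (J x)"], unfold_locales)
    fix x y
    have "(x + y - of_nat (J (x + y))) + - (x - of_nat (J x)) + - (y - of_nat (J y)) \<in> H"
      by (intro Hadd neg J)
    then have "- (of_nat (J (x + y)) - of_nat (J x + J y)) \<in> H"
      by (simp add: algebra_simps)
    from neg[OF this] have "e (J (x + y)) = e (J x + J y)"
      by (intro e_eq) (simp add: algebra_simps)
    then show "e (J (x + y)) = e (J x) * e (J y)" by (simp add: e_add)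
    show "cmod (e (J x)) = 1" by (simp add: e_def)
  next
    have "e 1 = e (J 1)" using J[of 1] by (intro e_eq) simp
    moreover have "e 1 \<noteq> 1" using e_1[of 1] prime_gt_1_nat[OF p] by simp
    ultimately show "e (J 1) \<noteq> 1" by simp
  qed
qed

context nontrivial_additive_character
begin

lemma zero: "\<psi> 0 = 1"
proof -
  have "\<psi> 0 * \<psi> 0 = \<psi> 0" using add[of 0 0] by simp
  then show ?thesis using norm_eq_1[of 0] by auto
qed

lemma cnj_eq: "cnj (\<psi> x) = \<psi> (- x)"
proof -
  have "\<psi> x * cnj (\<psi> x) = 1"
    using complex_norm_square[of "\<psi> x"] norm_eq_1[of x] by simp
  also have "\<dots> = \<psi> x * \<psi> (- x)"
    using add[of x "- x"] zero by simp
  finally show ?thesis using norm_eq_1[of x] by auto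
qed

lemma sum_eq_prod: "\<psi> (sum f S) = (\<Prod>x\<in>S. \<psi> (f x))"
  by (induction S rule: infinite_finite_induct) (auto simp: zero add)

lemma character_sum:
  "(\<Sum>x\<in>UNIV. \<psi> (x * v)) = (if v = 0 then of_nat CARD('a) else 0)"
proof (cases "v = 0")
  case True
  then show ?thesis by (simp add: zero)
next
  case False
  \<comment> \<open>The shift multiplies the sum by \<open>\<psi> 1\<close>, which differs from 1,
    so the sum vanishes.\<close>
  have "(\<Sum>x\<in>UNIV. \<psi> (x * v)) = (\<Sum>x\<in>UNIV. \<psi> ((x + inverse v) * v))"
    by (rule sum.reindex_bij_witness[of _ "\<lambda>x. x + inverse v" "\<lambda>x. x - inverse v"]) auto
  also have "\<dots> = (\<Sum>x\<in>UNIV. \<psi> (x * v)) * \<psi> 1"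
    using False by (simp add: distrib_right add sum_distrib_right)
  finally show ?thesis using nontrivial False by auto
qed

lemma character_sum_vector:
  "(\<Sum>c\<in>PiE {..<n} (\<lambda>_. UNIV). \<psi> (\<Sum>j<n. c j * v j))
         = (if \<forall>j<n. v j = 0 then of_nat (CARD('a) ^ n) else 0)"
proof -
  have "(\<Sum>c\<in>PiE {..<n} (\<lambda>_. UNIV). \<psi> (\<Sum>j<n. c j * v j)) = (\<Prod>j<n. \<Sum>y\<in>UNIV. \<psi> (y * v j))"
    by (simp add: sum_eq_prod prod_sum_PiE)
  also have "\<dots> = (\<Prod>j<n. if v j = 0 then of_nat CARD('a) else 0)"
    by (simp add: character_sum)
  also have "\<dots> = (if \<forall>j<n. v j = 0 then of_nat (CARD('a) ^ n) else 0)"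
    by (auto intro!: prod_zero)
  finally show ?thesis .
qed

definition gauss_power_sum :: "nat \<Rightarrow> 'a \<Rightarrow> complex" where
  "gauss_power_sum m u = (\<Sum>y\<in>UNIV. \<psi> (u * y ^ m))"

text \<open>Orthogonality over \<open>u\<close> counts the pairs with equal \<open>m\<close>-th
  powers, and a fibre of the power map has at most \<open>m\<close> points.\<close>

lemma gauss_power_sum_second_moment:
  assumes "m > 0"
  shows "(\<Sum>u\<in>UNIV. (cmod (gauss_power_sum m u))\<^sup>2) \<le> real m * real CARD('a) ^ 2"
proof -
  have "(\<Sum>u\<in>UNIV. (cmod (gauss_power_sum m u))\<^sup>2) \<le> real CARD('a) * real (card (UNIV :: 'a set)) * real m"
    unfolding gauss_power_sum_def
  proof (rule sum_norm_square_orthogonal[where F = "\<lambda>y. y ^ m"])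
    fix x x' :: 'a
    have "(\<Sum>c\<in>UNIV. \<psi> (c * x ^ m) * cnj (\<psi> (c * x' ^ m))) = (\<Sum>c\<in>UNIV. \<psi> (c * (x ^ m - x' ^ m)))"
      by (simp add: cnj_eq add[symmetric] algebra_simps)
    then show "(\<Sum>c\<in>UNIV. \<psi> (c * x ^ m) * cnj (\<psi> (c * x' ^ m))) = (if x ^ m = x' ^ m then of_nat CARD('a) else 0)"
      by (simp add: character_sum)
  qed (use card_nth_roots_le[OF \<open>m > 0\<close>] in auto)
  then show ?thesis by (simp add: power2_eq_square mult_ac)
qed

text \<open>The value at \<open>u\<close> recurs at every \<open>u s ^ m\<close> with \<open>s \<noteq> 0\<close>, so the second moment controls it.\<close>

lemma gauss_power_sum_bound:
  assumes "m > 0" "u \<noteq> 0"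
  shows "(cmod (gauss_power_sum m u))\<^sup>2 \<le> 2 * real m ^ 2 * real CARD('a)"
proof -
  let ?G = "\<lambda>u. (cmod (gauss_power_sum m u))\<^sup>2" and ?q = "real CARD('a)"
  have "card {0, 1 :: 'a} \<le> CARD('a)" by (rule card_mono) auto
  then have q2: "?q \<ge> 2" by simp
  have inv: "gauss_power_sum m (u * s ^ m) = gauss_power_sum m u" if "s \<noteq> 0" for s
    unfolding gauss_power_sum_def
    by (rule sum.reindex_bij_witness[of _ "\<lambda>y. y / s" "\<lambda>y. s * y"])
       (use that in \<open>auto simp: power_mult_distrib mult_ac\<close>)
  have "(?q - 1) * ?G u = (\<Sum>s\<in>UNIV - {0 :: 'a}. ?G u)"
    by (use q2 in \<open>simp add: card_Diff_singleton of_nat_diff\<close>)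
  also have "\<dots> = (\<Sum>s\<in>UNIV - {0}. ?G (u * s ^ m))"
    by (intro sum.cong refl) (simp add: inv)
  also have "\<dots> \<le> (\<Sum>s\<in>UNIV. ?G (u * s ^ m))"
    by (intro sum_mono2) auto
  also have "\<dots> = (\<Sum>s\<in>UNIV. \<Sum>v\<in>UNIV. if v = u * s ^ m then ?G v else 0)"
    by simp
  also have "\<dots> = (\<Sum>v\<in>UNIV. \<Sum>s\<in>UNIV. if v = u * s ^ m then ?G v else 0)"
    by (rule sum.swap)
  \<comment> \<open>Grouping by the value \<open>v = u * s ^ m\<close> costs a factor of at most
    \<open>m\<close>; the second moment contributes the other \<open>m\<close>.\<close>
  also have "\<dots> = (\<Sum>v\<in>UNIV. real (card {s. s ^ m = v / u}) * ?G v)"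
  proof (intro sum.cong refl)
    fix v
    have "{s. v = u * s ^ m} = {s. s ^ m = v / u}" using \<open>u \<noteq> 0\<close> by (auto simp: field_simps)
    then show "(\<Sum>s\<in>UNIV. if v = u * s ^ m then ?G v else 0) = real (card {s. s ^ m = v / u}) * ?G v"
      by (simp add: sum.If_cases)
  qed
  also have "\<dots> \<le> (\<Sum>v\<in>UNIV. real m * ?G v)"
    by (intro sum_mono mult_right_mono of_nat_mono card_nth_roots_le) (use \<open>m > 0\<close> in auto)
  also have "\<dots> = real m * (\<Sum>v\<in>UNIV. ?G v)" by (simp add: sum_distrib_left)
  also have "\<dots> \<le> real m * (real m * ?q ^ 2)"
    by (rule mult_left_mono[OF gauss_power_sum_second_moment]) (use \<open>m > 0\<close> in auto)
  finally have *: "(?q - 1) * ?G u \<le> real m * (real m * ?q ^ 2)" .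
  \<comment> \<open>Trading \<open>q - 1\<close> for \<open>q\<close> is where the constant 2 of the
    bound comes from.\<close>
  have "?q * ?G u \<le> 2 * (?q - 1) * ?G u"
    by (rule mult_right_mono) (use q2 in auto)
  also have "\<dots> = 2 * ((?q - 1) * ?G u)" by (rule mult.assoc)
  also have "\<dots> \<le> 2 * (real m * (real m * ?q ^ 2))"
    using * by (rule mult_left_mono) simp
  also have "\<dots> = ?q * (2 * real m ^ 2 * ?q)" by (simp only: power2_eq_square mult_ac)
  finally have **: "?q * ?G u \<le> ?q * (2 * real m ^ 2 * ?q)" .
  have "0 < ?q" using q2 by linarith
  then show ?thesis using ** by (simp only: mult_le_cancel_left_pos)
qed

end

subsection \<open>Fibres of the map in the first variables\<close>

text \<open>Full rank makes the chosen square submatrix invertible, and the vanishing forms say that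
  \<open>c\<close> lies in the kernel of its transpose.\<close>

lemma columns_combination_eq_0:
  fixes a :: "nat \<Rightarrow> nat \<Rightarrow> 'a::field"
  assumes S: "S \<subseteq> {0..<t}" "card S = n"
    and rank: "vec_space.rank n (submatrix (mat n t (\<lambda>(j, i). a j i)) {0..<n} S) = n"
    and zero: "\<And>i. i \<in> S \<Longrightarrow> (\<Sum>j<n. c j * a j i) = 0"
    and "j < n"
  shows "c j = 0"
proof -
  define B where "B = submatrix (mat n t (\<lambda>(j, i). a j i)) {0..<n} S"
  have rows: "{i. i < n \<and> i \<in> {0..<n}} = {0..<n}" and cols: "{j. j < t \<and> j \<in> S} = S"
    using S by auto
  have B: "B \<in> carrier_mat n n"
    unfolding B_def using S by (intro carrier_matI) (simp_all add: dim_submatrix rows cols)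
  \<comment> \<open>\<open>submatrix\<close> renumbers rows and columns through \<open>pick\<close>;
    on the full set of rows this is the identity.\<close>
  have pick_id: "pick {0..<n} r = r" if "r < n" for r
  proof -
    have "{b \<in> {0..<n}. b < r} = {0..<r}" using that by auto
    then show ?thesis using pick_card_in_set[of r "{0..<n}"] that by simp
  qed
  have pickS: "pick S l \<in> S" if "l < n" for l
    using pick_in_set[of l S] that S by simp
  have B_index: "B $$ (r, l) = a r (pick S l)" if "r < n" "l < n" for r l
    unfolding B_def using that S pickS[OF that(2)]
    by (subst submatrix_index) (auto simp: rows cols pick_id)
  have "det B\<^sup>T \<noteq> 0"
    using B rank vec_space.det_rank_iff[OF B] det_transpose[OF B] unfolding B_def by simp
  moreover have "B\<^sup>T *\<^sub>v vec n c = 0\<^sub>v n"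
  proof (rule eq_vecI)
    fix l assume "l < dim_vec (0\<^sub>v n)"
    then have l: "l < n" by simp
    then have "(B\<^sup>T *\<^sub>v vec n c) $ l = (\<Sum>r<n. a r (pick S l) * c r)"
      using B by (simp add: scalar_prod_def lessThan_atLeast0 B_index)
    then show "(B\<^sup>T *\<^sub>v vec n c) $ l = 0\<^sub>v n $ l"
      using zero[OF pickS[OF l]] l by (simp add: mult.commute)
  qed (use B in auto)
  ultimately have "vec n c = 0\<^sub>v n"
    using det_0_iff_vec_prod_zero_field[of "B\<^sup>T" n] B vec_carrier[of n c]
    by (metis transpose_carrier_mat)
  then show ?thesis using \<open>j < n\<close> by (metis index_vec index_zero_vec(1))
qed

text \<open>A trivial kernel gives injectivity, and both sides have \<open>q ^ n\<close> elements.
  The bijection is used to change variables in sums over \<open>c\<close> and to solve for a single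
  power of a variable.\<close>

lemma bij_betw_linear_forms:
  fixes a :: "nat \<Rightarrow> nat \<Rightarrow> 'a::{finite,field}"
  assumes "finite S" "card S = n"
    and inj: "\<And>c j. (\<And>i. i \<in> S \<Longrightarrow> (\<Sum>j<n. c j * a j i) = 0) \<Longrightarrow> j < n \<Longrightarrow> c j = 0"
  shows "bij_betw (\<lambda>c. \<lambda>i\<in>S. \<Sum>j<n. c j * a j i) (PiE {..<n} (\<lambda>_. UNIV)) (PiE S (\<lambda>_. UNIV))"
proof -
  let ?f = "\<lambda>c. \<lambda>i\<in>S. \<Sum>j<n. c j * a j i" and ?C = "PiE {..<n} (\<lambda>_. UNIV :: 'a set)"
  let ?D = "PiE S (\<lambda>_. UNIV :: 'a set)"
  have inj_f: "inj_on ?f ?C"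
  proof (rule inj_onI)
    fix c c' assume c: "c \<in> ?C" "c' \<in> ?C" "?f c = ?f c'"
    have "(\<Sum>j<n. (c j - c' j) * a j i) = 0" if "i \<in> S" for i
      using fun_cong[OF c(3), of i] that by (simp add: left_diff_distrib sum_subtractf)
    then have "c j - c' j = 0" if "j < n" for j using inj[of "\<lambda>j. c j - c' j" j] that by blast
    then have "c j = c' j" if "j \<in> {..<n}" for j using that by auto
    with c(1,2) show "c = c'" by (rule PiE_ext)
  qed
  have sub: "?f ` ?C \<subseteq> ?D" by (intro image_subsetI) (simp add: restrict_PiE_iff)
  have fin: "finite ?D" using assms(1) by (intro finite_PiE) auto
  have "card ?C = card ?D" using assms(1,2) by (simp add: card_PiE)
  then have "card (?f ` ?C) = card ?D" using card_image[OF inj_f] by (rule trans[rotated])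
  then have "?f ` ?C = ?D" by (rule card_subset_eq[OF fin sub])
  then show ?thesis unfolding bij_betw_def by (rule conjI[OF inj_f])
qed

section \<open>Polynomial functions on a set and their reduction to bounded exponents\<close>

definition monomial_fun :: "nat \<Rightarrow> (nat \<Rightarrow> nat) \<Rightarrow> (nat \<Rightarrow> 'a) \<Rightarrow> 'a::comm_semiring_1" where
  "monomial_fun k e x = (\<Prod>i<k. x i ^ e i)"

text \<open>The polynomial functions in \<open>k\<close> variables of total degree strictly below
  \<open>s\<close>, generated inductively so that the rewriting argument can proceed by rule
  induction. The rule \<open>zero\<close> supplies empty sums even for \<open>s = 0\<close>, when
  there are no monomials.\<close>

inductive_set poly_funs_below :: "nat \<Rightarrow> nat \<Rightarrow> ((nat \<Rightarrow> 'a) \<Rightarrow> 'a::comm_semiring_1) set" for k s where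
  monomial: "(\<Sum>i<k. e i) < s \<Longrightarrow> monomial_fun k e \<in> poly_funs_below k s"
| zero: "(\<lambda>_. 0) \<in> poly_funs_below k s"
| add: "f \<in> poly_funs_below k s \<Longrightarrow> g \<in> poly_funs_below k s \<Longrightarrow> (\<lambda>x. f x + g x) \<in> poly_funs_below k s"
| scale: "f \<in> poly_funs_below k s \<Longrightarrow> (\<lambda>x. b * f x) \<in> poly_funs_below k s"

lemma poly_funs_below_sum:
  assumes "\<And>i. i \<in> I \<Longrightarrow> f i \<in> poly_funs_below k s"
  shows "(\<lambda>x. \<Sum>i\<in>I. f i x) \<in> poly_funs_below k s"
  using assms
  by (induction I rule: infinite_finite_induct) (auto intro: poly_funs_below.intros)

lemma poly_funs_below_const:
  assumes "0 < s"
  shows "(\<lambda>_. b) \<in> poly_funs_below k s"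
  using poly_funs_below.scale[OF poly_funs_below.monomial[where e = "\<lambda>_. 0"], of k s b] assms
  by (simp add: monomial_fun_def)

lemma mp_eval_in_poly_funs_below:
  assumes "mp_vars_below k p" "mp_totdeg p < s"
  shows "mp_eval p \<in> poly_funs_below k s"
proof -
  have "(\<lambda>x. \<Sum>m\<in>Poly_Mapping.keys p. Poly_Mapping.lookup p m * monomial_fun k (Poly_Mapping.lookup m) x) \<in> poly_funs_below k s"
  proof (intro poly_funs_below_sum poly_funs_below.scale poly_funs_below.monomial)
    fix m assume m: "m \<in> Poly_Mapping.keys p"
    have km: "Poly_Mapping.keys m \<subseteq> {..<k}"
      using assms(1) m unfolding mp_vars_below_def lessThan_atLeast0 by blast
    have "(\<Sum>i<k. Poly_Mapping.lookup m i) = sum (Poly_Mapping.lookup m) (Poly_Mapping.keys m)"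
      by (rule sum.mono_neutral_right[OF _ km]) (auto simp: in_keys_iff)
    also have "\<dots> \<le> mp_totdeg p"
      unfolding mp_totdeg_def using m by (intro Max_ge) auto
    finally show "(\<Sum>i<k. Poly_Mapping.lookup m i) < s" using assms(2) by simp
  qed
  also have "(\<lambda>x. \<Sum>m\<in>Poly_Mapping.keys p. Poly_Mapping.lookup p m * monomial_fun k (Poly_Mapping.lookup m) x) = mp_eval p"
    unfolding mp_eval_def monomial_fun_def
  proof (intro ext sum.cong refl arg_cong2[where f = "(*)"])
    fix x :: "nat \<Rightarrow> 'a" and m assume m: "m \<in> Poly_Mapping.keys p"
    have km: "Poly_Mapping.keys m \<subseteq> {..<k}"
      using assms(1) m unfolding mp_vars_below_def lessThan_atLeast0 by blast
    show "(\<Prod>i<k. x i ^ Poly_Mapping.lookup m i) = (\<Prod>i\<in>Poly_Mapping.keys m. x i ^ Poly_Mapping.lookup m i)"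
      by (rule prod.mono_neutral_right[OF _ km]) (auto simp: in_keys_iff)
  qed
  finally show ?thesis .
qed

text \<open>Equality is required only on \<open>Z\<close>, so this plays the part of a span in the
  polynomial ring modulo the functions vanishing on \<open>Z\<close>.\<close>

definition reduced_span :: "nat \<Rightarrow> (nat \<Rightarrow> nat) \<Rightarrow> (nat \<Rightarrow> 'a) set \<Rightarrow> ((nat \<Rightarrow> 'a) \<Rightarrow> 'a::comm_semiring_1) set" where
  "reduced_span k d Z = {f. \<exists>b. \<forall>x\<in>Z. f x = (\<Sum>e\<in>PiE {..<k} (\<lambda>i. {..<d i}). b e * monomial_fun k e x)}"

lemma reduced_span_add:
  assumes "f \<in> reduced_span k d Z" "g \<in> reduced_span k d Z"
  shows "(\<lambda>x. f x + g x) \<in> reduced_span k d Z"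
proof -
  obtain b b' where "\<forall>x\<in>Z. f x = (\<Sum>e\<in>PiE {..<k} (\<lambda>i. {..<d i}). b e * monomial_fun k e x)"
     "\<forall>x\<in>Z. g x = (\<Sum>e\<in>PiE {..<k} (\<lambda>i. {..<d i}). b' e * monomial_fun k e x)"
    using assms unfolding reduced_span_def by blast
  then show ?thesis unfolding reduced_span_def
    by (intro CollectI exI[of _ "\<lambda>e. b e + b' e"]) (simp add: distrib_right sum.distrib)
qed

lemma reduced_span_scale:
  assumes "f \<in> reduced_span k d Z"
  shows "(\<lambda>x. c * f x) \<in> reduced_span k d Z"
proof -
  obtain b where "\<forall>x\<in>Z. f x = (\<Sum>e\<in>PiE {..<k} (\<lambda>i. {..<d i}). b e * monomial_fun k e x)"
    using assms unfolding reduced_span_def by blast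
  then show ?thesis unfolding reduced_span_def
    by (intro CollectI exI[of _ "\<lambda>e. c * b e"]) (simp add: sum_distrib_left mult_ac)
qed

lemma reduced_span_zero: "(\<lambda>_. 0) \<in> reduced_span k d Z"
  unfolding reduced_span_def by (intro CollectI exI[of _ "\<lambda>_. 0"]) simp

lemma reduced_span_sum:
  assumes "\<And>i. i \<in> I \<Longrightarrow> f i \<in> reduced_span k d Z"
  shows "(\<lambda>x. \<Sum>i\<in>I. f i x) \<in> reduced_span k d Z"
  using assms
  by (induction I rule: infinite_finite_induct) (auto intro: reduced_span_add reduced_span_zero)

lemma reduced_span_cong:
  assumes "f \<in> reduced_span k d Z" "\<And>x. x \<in> Z \<Longrightarrow> f x = g x"
  shows "g \<in> reduced_span k d Z"
  using assms unfolding reduced_span_def by auto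

lemma reduced_monomial_in_reduced_span:
  assumes "\<And>i. i < k \<Longrightarrow> e i < d i"
  shows "monomial_fun k e \<in> reduced_span k d Z"
proof -
  let ?E = "PiE {..<k} (\<lambda>i. {..<d i})"
  \<comment> \<open>The index set is extensional, while \<open>monomial_fun\<close> reads only the
    exponents below \<open>k\<close>; restriction reconciles the two.\<close>
  have e: "restrict e {..<k} \<in> ?E" and "finite ?E" using assms by (auto intro: finite_PiE)
  then have "monomial_fun k e x = (\<Sum>e'\<in>?E. (if e' = restrict e {..<k} then 1 else 0) * monomial_fun k e' x)" for x
    by (simp add: if_distrib[of "\<lambda>u. u * _"] cong: if_cong) (simp add: monomial_fun_def)
  then show ?thesis unfolding reduced_span_def
    by (intro CollectI exI[of _ "\<lambda>e'. if e' = restrict e {..<k} then 1 else 0"]) blast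
qed

text \<open>The relations \<open>x\<^sub>i ^ d\<^sub>i = lower degree\<close> rewrite every non-reduced monomial into
  monomials of smaller total degree.\<close>

lemma monomial_in_reduced_span:
  assumes red: "\<And>i. i < k \<Longrightarrow> \<exists>f\<in>poly_funs_below k (d i). \<forall>x\<in>Z. x i ^ d i = f x"
  shows "monomial_fun k e \<in> reduced_span k d Z"
proof (induction "\<Sum>i<k. e i" arbitrary: e rule: less_induct)
  case less
  show ?case
  proof (cases "\<forall>i<k. e i < d i")
    case True
    then show ?thesis by (intro reduced_monomial_in_reduced_span) auto
  next
    case False
    then obtain i where i: "i < k" "d i \<le> e i" by (auto simp: not_less)
    define e' where "e' = e(i := e i - d i)"
    have e'_eq: "e l = e' l + (if l = i then d i else 0)" for l using i by (simp add: e'_def)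
    have deg: "(\<Sum>l<k. e l) = (\<Sum>l<k. e' l) + d i"
      unfolding e'_eq using i by (simp add: sum.distrib)
    obtain f where f: "f \<in> poly_funs_below k (d i)" "\<And>x. x \<in> Z \<Longrightarrow> x i ^ d i = f x"
      using red[OF i(1)] by blast
    \<comment> \<open>All monomials of \<open>f\<close> have degree below \<open>d i\<close>, so the
      products with \<open>e'\<close> have degree below that of \<open>e\<close> and the induction
      hypothesis covers them.\<close>
    have "(\<lambda>x. monomial_fun k e' x * f x) \<in> reduced_span k d Z" using f(1)
    proof (induction rule: poly_funs_below.induct)
      case (monomial e'')
      have "monomial_fun k (\<lambda>l. e' l + e'' l) \<in> reduced_span k d Z"
        by (rule less) (use monomial deg in \<open>simp add: sum.distrib\<close>)
      then show ?case
        by (rule reduced_span_cong) (simp add: monomial_fun_def power_add prod.distrib)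
    next
      case zero
      then show ?case by (simp add: reduced_span_zero)
    next
      case (add f g)
      from reduced_span_add[OF add.IH] show ?case by (simp add: distrib_left)
    next
      case (scale f b)
      from reduced_span_scale[OF scale.IH] show ?case by (simp add: mult_ac)
    qed
    then show ?thesis
    proof (rule reduced_span_cong)
      fix x assume "x \<in> Z"
      have "monomial_fun k e x = monomial_fun k e' x * (\<Prod>l<k. x l ^ (if l = i then d i else 0))"
        unfolding monomial_fun_def e'_eq by (simp add: power_add prod.distrib)
      also have "(\<Prod>l<k. x l ^ (if l = i then d i else 0)) = (\<Prod>l<k. if l = i then x i ^ d i else 1)"
        by (intro prod.cong) auto
      also have "\<dots> = f x" using i f(2)[OF \<open>x \<in> Z\<close>] by simp
      finally show "monomial_fun k e' x * f x = monomial_fun k e x" by simp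
    qed
  qed
qed

text \<open>Multiplication by \<open>x i\<close> may push an exponent up to \<open>d i\<close>;
  \<open>mon\<close> brings the resulting monomial back into the span.\<close>

lemma reduced_span_mult_linear:
  fixes f :: "(nat \<Rightarrow> 'a::comm_ring_1) \<Rightarrow> 'a"
  assumes mon: "\<And>e. monomial_fun k e \<in> reduced_span k d Z"
    and f: "f \<in> reduced_span k d Z" and "i < k"
  shows "(\<lambda>x. (x i - c) * f x) \<in> reduced_span k d Z"
proof -
  let ?E = "PiE {..<k} (\<lambda>i. {..<d i})"
  obtain b where b: "\<And>x. x \<in> Z \<Longrightarrow> f x = (\<Sum>e\<in>?E. b e * monomial_fun k e x)"
    using f unfolding reduced_span_def by blast
  have *: "monomial_fun k (e(i := Suc (e i))) x = x i * monomial_fun k e x" for e and x :: "nat \<Rightarrow> 'a"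
    unfolding monomial_fun_def using \<open>i < k\<close>
    by (simp add: prod.remove[of "{..<k}" i] mult_ac)
  have "(\<lambda>x. \<Sum>e\<in>?E. b e * monomial_fun k (e(i := Suc (e i))) x) \<in> reduced_span k d Z"
    by (intro reduced_span_sum reduced_span_scale mon)
  then have "(\<lambda>x. x i * f x) \<in> reduced_span k d Z"
    by (rule reduced_span_cong) (simp add: * b sum_distrib_left mult_ac)
  from reduced_span_add[OF this reduced_span_scale[OF f, of "- c"]] show ?thesis
    by (simp add: algebra_simps)
qed

lemma reduced_span_prod_linear:
  fixes w :: "'b \<Rightarrow> 'a::comm_ring_1"
  assumes mon: "\<And>e. monomial_fun k e \<in> reduced_span k d Z"
    and "finite J" "\<And>j. j \<in> J \<Longrightarrow> i j < k"
  shows "(\<lambda>x. \<Prod>j\<in>J. x (i j) - w j) \<in> reduced_span k d Z"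
  using assms(2,3)
proof (induction J rule: finite_induct)
  case empty
  have "(\<lambda>x::nat \<Rightarrow> 'a. 1 :: 'a) = monomial_fun k (\<lambda>_. 0)" by (simp add: monomial_fun_def fun_eq_iff)
  then show ?case using mon[of "\<lambda>_. 0"] by (simp only: prod.empty)
next
  case (insert j J)
  then show ?case using reduced_span_mult_linear[OF mon, of "\<lambda>x. \<Prod>j\<in>J. x (i j) - w j" "i j" "w j"]
    by simp
qed

text \<open>Every function on \<open>Z\<close> lies in the span of the reduced monomials, so there are
  at most \<open>q ^ (\<Prod>d\<^sub>i)\<close> of them.\<close>

lemma card_le_prod_degrees:
  fixes Z :: "(nat \<Rightarrow> 'a::{finite,field}) set"
  assumes Z: "Z \<subseteq> PiE {..<k} (\<lambda>_. UNIV)"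
    and red: "\<And>i. i < k \<Longrightarrow> \<exists>f\<in>poly_funs_below k (d i). \<forall>x\<in>Z. x i ^ d i = f x"
  shows "card Z \<le> (\<Prod>i<k. d i)"
proof -
  let ?E = "PiE {..<k} (\<lambda>i. {..<d i})"
  let ?C = "PiE ?E (\<lambda>_. UNIV :: 'a set)" and ?F = "PiE Z (\<lambda>_. UNIV :: 'a set)"
  have finE: "finite ?E" by (intro finite_PiE) auto
  have finZ: "finite Z" by (rule finite_subset[OF Z]) (intro finite_PiE, auto)
  have mon: "monomial_fun k e \<in> reduced_span k d Z" for e
    using red by (rule monomial_in_reduced_span)
  have all: "h \<in> reduced_span k d Z" for h
  proof -
    \<comment> \<open>Up to a nonzero scalar, \<open>\<delta> w\<close> is the indicator function of
      \<open>w\<close> on \<open>Z\<close>: every wrong value of every coordinate is a root.\<close>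
    define \<delta> where "\<delta> w x = (\<Prod>j\<in>Sigma {..<k} (\<lambda>i. UNIV - {w i}). x (fst j) - snd j)" for w x :: "nat \<Rightarrow> 'a"
    have \<delta>_span: "\<delta> w \<in> reduced_span k d Z" for w
      unfolding \<delta>_def by (rule reduced_span_prod_linear[OF mon]) auto
    have \<delta>_self: "\<delta> w w \<noteq> 0" for w
      unfolding \<delta>_def by auto
    have \<delta>_other: "\<delta> w x = 0" if xw: "x \<in> Z" "w \<in> Z" "x \<noteq> w" for x w
    proof -
      obtain i where "i < k" "x i \<noteq> w i" using xw Z PiE_ext[of x "{..<k}" "\<lambda>_. UNIV" w] by blast
      then show ?thesis unfolding \<delta>_def
        by (intro prod_zero) (auto intro!: bexI[of _ "(i, x i)"])
    qed
    \<comment> \<open>Lagrange interpolation of \<open>h\<close> on \<open>Z\<close>.\<close>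
    have "(\<lambda>x. \<Sum>w\<in>Z. h w / \<delta> w w * \<delta> w x) \<in> reduced_span k d Z"
      by (intro reduced_span_sum reduced_span_scale \<delta>_span)
    then show ?thesis
    proof (rule reduced_span_cong)
      fix x assume x: "x \<in> Z"
      have "(\<Sum>w\<in>Z. h w / \<delta> w w * \<delta> w x) = (\<Sum>w\<in>Z. if w = x then h x else 0)"
        by (intro sum.cong refl) (use \<delta>_other[OF x] \<delta>_self in auto)
      then show "(\<Sum>w\<in>Z. h w / \<delta> w w * \<delta> w x) = h x" using x finZ by simp
    qed
  qed
  \<comment> \<open>Coefficient families map onto the functions on \<open>Z\<close>, so
    \<open>q ^ card Z\<close> is at most \<open>q ^ card ?E\<close>.\<close>
  have "?F \<subseteq> (\<lambda>b. \<lambda>x\<in>Z. \<Sum>e\<in>?E. b e * monomial_fun k e x) ` ?C"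
  proof
    fix h assume h: "h \<in> ?F"
    obtain b where b: "\<And>x. x \<in> Z \<Longrightarrow> h x = (\<Sum>e\<in>?E. b e * monomial_fun k e x)"
      using all[of h] unfolding reduced_span_def by blast
    have "h = (\<lambda>x\<in>Z. \<Sum>e\<in>?E. restrict b ?E e * monomial_fun k e x)"
    proof
      fix x
      show "h x = (\<lambda>x\<in>Z. \<Sum>e\<in>?E. restrict b ?E e * monomial_fun k e x) x"
        using h b by (cases "x \<in> Z") (auto simp: PiE_def extensional_def intro!: sum.cong)
    qed
    then show "h \<in> (\<lambda>b. \<lambda>x\<in>Z. \<Sum>e\<in>?E. b e * monomial_fun k e x) ` ?C"
      by (rule image_eqI[where x = "restrict b ?E"]) (simp add: restrict_PiE_iff)
  qed
  then have "card ?F \<le> card ?C"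
    using finE by (intro surj_card_le) (auto intro: finite_PiE)
  then have "CARD('a) ^ card Z \<le> CARD('a) ^ card ?E"
    using finE finZ by (simp add: card_PiE)
  moreover have "card {0, 1 :: 'a} \<le> CARD('a)" by (rule card_mono) auto
  ultimately have "card Z \<le> card ?E" by (simp add: power_increasing_iff)
  also have "card ?E = (\<Prod>i<k. d i)" by (simp add: card_PiE)
  finally show ?thesis .
qed

subsection \<open>The counting inequality\<close>

text \<open>For nonzero \<open>c\<close> fewer than \<open>n\<close> forms vanish, so their indices
  fit into an \<open>n\<close>-subset \<open>S\<close> of \<open>K\<close>. Factors outside
  \<open>S\<close> are bounded by \<open>B\<close>; on \<open>S\<close> the forms are independent
  coordinates, and summing over \<open>c\<close> gives \<open>n\<close> separate moments. The power
  of 2 bounds the number of choices of \<open>S\<close>.\<close>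

lemma sum_prod_linear_forms_le:
  fixes a :: "nat \<Rightarrow> nat \<Rightarrow> 'a::{finite,field}" and f :: "nat \<Rightarrow> 'a \<Rightarrow> real"
  assumes K: "finite K" "card K = m" "n \<le> m"
    and inj: "\<And>S c j. S \<subseteq> K \<Longrightarrow> card S = n \<Longrightarrow> (\<And>i. i \<in> S \<Longrightarrow> (\<Sum>j<n. c j * a j i) = 0) \<Longrightarrow> j < n \<Longrightarrow> c j = 0"
    and nonneg: "\<And>i v. 0 \<le> f i v"
    and bound: "\<And>i v. i \<in> K \<Longrightarrow> v \<noteq> 0 \<Longrightarrow> f i v \<le> B"
    and moment: "\<And>i. i \<in> K \<Longrightarrow> (\<Sum>v\<in>UNIV. f i v) \<le> M"
    and "0 \<le> B"
  shows "(\<Sum>c\<in>PiE {..<n} (\<lambda>_. UNIV) - {\<lambda>j\<in>{..<n}. 0}. \<Prod>i\<in>K. f i (\<Sum>j<n. c j * a j i))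
         \<le> 2 ^ m * (B ^ (m - n) * M ^ n)"
proof -
  let ?C = "PiE {..<n} (\<lambda>_. UNIV :: 'a set)" and ?u = "\<lambda>c i. \<Sum>j<n. c j * a j i"
  define \<S> where "\<S> = {S. S \<subseteq> K \<and> card S = n}"
  have fin: "finite ?C" "finite \<S>" using K by (auto simp: \<S>_def intro!: finite_PiE)
  have finS: "finite S" if "S \<in> \<S>" for S using that K finite_subset unfolding \<S>_def by blast
  have pointwise: "(\<Prod>i\<in>K. f i (?u c i)) \<le> (\<Sum>S\<in>\<S>. B ^ (m - n) * (\<Prod>i\<in>S. f i (?u c i)))"
    if c: "c \<in> ?C - {\<lambda>j\<in>{..<n}. 0}" for c
  proof -
    define Z where "Z = {i \<in> K. ?u c i = 0}"
    have "card Z < n"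
    proof (rule ccontr)
      assume "\<not> card Z < n"
      then obtain S where S: "S \<subseteq> Z" "card S = n" "finite S"
        using obtain_subset_with_card_n[of n Z] by (auto simp: not_less)
      then have "c j = 0" if "j < n" for j
        using inj[of S c j] that unfolding Z_def by blast
      then have "c = (\<lambda>j\<in>{..<n}. 0)" using c by (intro ext) (auto simp: PiE_def extensional_def)
      with c show False by blast
    qed
    \<comment> \<open>The set of zeros is enlarged to exactly \<open>n\<close> indices so that the
      change of variables applies. As \<open>S\<close> depends on \<open>c\<close>, the bound sums
      over all candidates.\<close>
    then obtain S where S: "Z \<subseteq> S" "S \<subseteq> K" "card S = n"
      using exists_subset_between[of Z n K] K unfolding Z_def by auto
    then have "S \<in> \<S>" by (simp add: \<S>_def)
    have "(\<Prod>i\<in>K. f i (?u c i)) = (\<Prod>i\<in>K - S. f i (?u c i)) * (\<Prod>i\<in>S. f i (?u c i))"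
      by (rule prod.subset_diff[OF S(2) K(1)])
    also have "\<dots> \<le> (\<Prod>i\<in>K - S. B) * (\<Prod>i\<in>S. f i (?u c i))"
      using S by (intro mult_right_mono prod_mono prod_nonneg ballI conjI nonneg bound) (auto simp: Z_def)
    also have "(\<Prod>i\<in>K - S. B) = B ^ (m - n)"
      using S K finS[OF \<open>S \<in> \<S>\<close>] by (simp add: card_Diff_subset)
    also have "B ^ (m - n) * (\<Prod>i\<in>S. f i (?u c i)) \<le> (\<Sum>S\<in>\<S>. B ^ (m - n) * (\<Prod>i\<in>S. f i (?u c i)))"
      using \<open>0 \<le> B\<close>
      by (intro member_le_sum[OF \<open>S \<in> \<S>\<close>] fin mult_nonneg_nonneg zero_le_power prod_nonneg nonneg)
    finally show ?thesis .
  qed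
  have "(\<Sum>c\<in>?C - {\<lambda>j\<in>{..<n}. 0}. \<Prod>i\<in>K. f i (?u c i))
      \<le> (\<Sum>c\<in>?C - {\<lambda>j\<in>{..<n}. 0}. \<Sum>S\<in>\<S>. B ^ (m - n) * (\<Prod>i\<in>S. f i (?u c i)))"
    by (intro sum_mono pointwise)
  also have "\<dots> \<le> (\<Sum>c\<in>?C. \<Sum>S\<in>\<S>. B ^ (m - n) * (\<Prod>i\<in>S. f i (?u c i)))"
    using \<open>0 \<le> B\<close> fin
    by (intro sum_mono2 sum_nonneg mult_nonneg_nonneg zero_le_power prod_nonneg nonneg) auto
  also have "\<dots> = (\<Sum>S\<in>\<S>. B ^ (m - n) * (\<Sum>c\<in>?C. \<Prod>i\<in>S. f i (?u c i)))"
    by (subst sum.swap) (simp add: sum_distrib_left)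
  also have "\<dots> \<le> (\<Sum>S\<in>\<S>. B ^ (m - n) * M ^ n)"
  proof (intro sum_mono mult_left_mono)
    fix S assume "S \<in> \<S>"
    then have S: "S \<subseteq> K" "card S = n" by (auto simp: \<S>_def)
    have bij: "bij_betw (\<lambda>c. \<lambda>i\<in>S. ?u c i) ?C (PiE S (\<lambda>_. UNIV))"
      using inj[OF S] by (rule bij_betw_linear_forms[OF finS[OF \<open>S \<in> \<S>\<close>] S(2)])
    have "(\<Sum>c\<in>?C. \<Prod>i\<in>S. f i (?u c i)) = (\<Sum>c\<in>?C. \<Prod>i\<in>S. f i ((\<lambda>i\<in>S. ?u c i) i))"
      by (intro sum.cong prod.cong refl) simp
    also have "\<dots> = (\<Sum>w\<in>PiE S (\<lambda>_. UNIV). \<Prod>i\<in>S. f i (w i))"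
      using bij by (rule sum.reindex_bij_betw)
    also have "\<dots> = (\<Prod>i\<in>S. \<Sum>v\<in>UNIV. f i v)"
      by (rule prod_sum_PiE[symmetric]) (use finS[OF \<open>S \<in> \<S>\<close>] in auto)
    also have "\<dots> \<le> (\<Prod>i\<in>S. M)"
      using S by (intro prod_mono conjI sum_nonneg nonneg moment) auto
    finally show "(\<Sum>c\<in>?C. \<Prod>i\<in>S. f i (?u c i)) \<le> M ^ n" using S by simp
  qed (use \<open>0 \<le> B\<close> in auto)
  also have "\<dots> = real (m choose n) * (B ^ (m - n) * M ^ n)"
    using n_subsets[OF K(1), of n] K(2) by (simp add: \<S>_def)
  also have "\<dots> \<le> 2 ^ m * (B ^ (m - n) * M ^ n)"
  proof (cases "n = 0")
    \<comment> \<open>With \<open>n = 0\<close> the set \<open>K\<close> may be empty, so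
      \<open>moment\<close> need not give \<open>0 \<le> M\<close>; but then \<open>M ^ n\<close> is
      1.\<close>
    case True
    have "1 * B ^ m \<le> 2 ^ m * B ^ m"
      by (rule mult_right_mono[OF one_le_power]) (use \<open>0 \<le> B\<close> in auto)
    with True show ?thesis by simp
  next
    case False
    then obtain i where "i \<in> K" using K by (metis card_gt_0_iff ex_in_conv gr0I le_zero_eq)
    then have "0 \<le> M" using moment[of i] nonneg sum_nonneg[of UNIV "f i"] by (meson order_trans)
    moreover have "real (m choose n) \<le> real (2 ^ m)" using binomial_le_pow2 by (rule of_nat_mono)
    ultimately show ?thesis using \<open>0 \<le> B\<close> by (intro mult_right_mono) auto
  qed
  finally show ?thesis .
qed

context nontrivial_additive_character
begin

text \<open>The left side is the square of the term at \<open>c = 0\<close>, which the other terms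
  must cancel. Cauchy-Schwarz separates \<open>T\<close> from \<open>P\<close>, so only the fibre
  size of \<open>F\<close> enters.\<close>

lemma no_solution_inequality:
  fixes a :: "nat \<Rightarrow> nat \<Rightarrow> 'a" and F :: "nat \<Rightarrow> 'b \<Rightarrow> 'a"
  assumes K: "finite K" "card K = m" "n \<le> m"
    and inj: "\<And>S c j. S \<subseteq> K \<Longrightarrow> card S = n \<Longrightarrow> (\<And>i. i \<in> S \<Longrightarrow> (\<Sum>j<n. c j * a j i) = 0) \<Longrightarrow> j < n \<Longrightarrow> c j = 0"
    and d: "\<And>i. i \<in> K \<Longrightarrow> 0 < d i" "\<And>i. i \<in> K \<Longrightarrow> d i \<le> d0"
    and X: "finite X" "\<And>x. x \<in> X \<Longrightarrow> card {x' \<in> X. \<forall>j<n. F j x' = F j x} \<le> D"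
    and none: "\<And>x y. x \<in> X \<Longrightarrow> y \<in> PiE K (\<lambda>_. UNIV) \<Longrightarrow>
       \<exists>j<n. F j x + (\<Sum>i\<in>K. a j i * y i ^ d i) \<noteq> 0"
  shows "(real (card X) * real CARD('a) ^ m)\<^sup>2 \<le> (real CARD('a) ^ n * real (card X) * real D)
    * (2 ^ m * ((2 * real d0 ^ 2 * real CARD('a)) ^ (m - n) * (real d0 * real CARD('a) ^ 2) ^ n))"
proof -
  let ?C = "PiE {..<n} (\<lambda>_. UNIV :: 'a set)" and ?Y = "PiE K (\<lambda>_. UNIV :: 'a set)"
  let ?u = "\<lambda>c i. \<Sum>j<n. c j * a j i" and ?o = "\<lambda>j\<in>{..<n}. 0 :: 'a"
  define T where "T c = (\<Sum>x\<in>X. \<psi> (\<Sum>j<n. c j * F j x))" for c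
  define P where "P c = (\<Prod>i\<in>K. gauss_power_sum (d i) (?u c i))" for c
  have fin: "finite ?C" by (auto intro!: finite_PiE)
  have P_eq: "P c = (\<Sum>y\<in>?Y. \<psi> (\<Sum>i\<in>K. ?u c i * y i ^ d i))" for c
    unfolding P_def gauss_power_sum_def sum_eq_prod by (rule prod_sum_PiE) (use K in auto)
  have arg: "(\<Sum>j<n. c j * (F j x + (\<Sum>i\<in>K. a j i * y i ^ d i)))
      = (\<Sum>j<n. c j * F j x) + (\<Sum>i\<in>K. ?u c i * y i ^ d i)" for c x y
  proof -
    have "(\<Sum>j<n. c j * (\<Sum>i\<in>K. a j i * y i ^ d i)) = (\<Sum>i\<in>K. ?u c i * y i ^ d i)"
      by (simp only: sum_distrib_left sum_distrib_right mult.assoc) (rule sum.swap)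
    then show ?thesis by (simp add: distrib_left sum.distrib)
  qed
  have "(\<Sum>c\<in>?C. T c * P c)
      = (\<Sum>c\<in>?C. \<Sum>x\<in>X. \<Sum>y\<in>?Y. \<psi> (\<Sum>j<n. c j * (F j x + (\<Sum>i\<in>K. a j i * y i ^ d i))))"
    unfolding T_def P_eq arg add by (simp add: sum_product)
  also have "\<dots> = (\<Sum>x\<in>X. \<Sum>y\<in>?Y. \<Sum>c\<in>?C. \<psi> (\<Sum>j<n. c j * (F j x + (\<Sum>i\<in>K. a j i * y i ^ d i))))"
    by (subst sum.swap) (intro sum.cong sum.swap refl)
  \<comment> \<open>For fixed \<open>x\<close> and \<open>y\<close> the sum over \<open>c\<close>
    detects whether all \<open>n\<close> equations hold, which never happens.\<close>
  also have "\<dots> = 0"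
    unfolding character_sum_vector using none by (intro sum.neutral ballI) auto
  finally have total: "(\<Sum>c\<in>?C. T c * P c) = 0" .
  have "?o \<in> ?C" by auto
  have "T ?o = of_nat (card X)" unfolding T_def by (simp add: zero)
  moreover have "P ?o = of_nat CARD('a) ^ m"
    unfolding P_def gauss_power_sum_def using K by (simp add: zero)
  ultimately have main: "of_nat (card X) * of_nat CARD('a) ^ m = - (\<Sum>c\<in>?C - {?o}. T c * P c)"
    using total sum.remove[OF fin \<open>?o \<in> ?C\<close>, of "\<lambda>c. T c * P c"] by (simp add: add_eq_0_iff2)
  have "real (card X) * real CARD('a) ^ m = cmod (of_nat (card X) * of_nat CARD('a) ^ m)"
    by (simp only: norm_mult norm_power norm_of_nat)
  also have "\<dots> = cmod (\<Sum>c\<in>?C - {?o}. T c * P c)"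
    unfolding main by (rule norm_minus_cancel)
  also have "\<dots> \<le> (\<Sum>c\<in>?C - {?o}. cmod (T c) * cmod (P c))"
    by (rule order_trans[OF norm_sum]) (simp add: norm_mult)
  finally have "(real (card X) * real CARD('a) ^ m)\<^sup>2 \<le> (\<Sum>c\<in>?C - {?o}. cmod (T c) * cmod (P c))\<^sup>2"
    by (rule power_mono) simp
  also have "\<dots> \<le> (\<Sum>c\<in>?C - {?o}. (cmod (T c))\<^sup>2) * (\<Sum>c\<in>?C - {?o}. (cmod (P c))\<^sup>2)"
    by (rule Cauchy_Schwarz_ineq_sum)
  also have "\<dots> \<le> (real CARD('a) ^ n * real (card X) * real D)
    * (2 ^ m * ((2 * real d0 ^ 2 * real CARD('a)) ^ (m - n) * (real d0 * real CARD('a) ^ 2) ^ n))"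
  proof (rule mult_mono)
    \<comment> \<open>Orthogonality needs the complete sum, so the term at \<open>c = 0\<close> is
      put back.\<close>
    have "(\<Sum>c\<in>?C - {?o}. (cmod (T c))\<^sup>2) \<le> (\<Sum>c\<in>?C. (cmod (T c))\<^sup>2)"
      using fin by (intro sum_mono2) auto
    also have "\<dots> \<le> real (CARD('a) ^ n) * real (card X) * real D"
      unfolding T_def
    proof (rule sum_norm_square_orthogonal[where F = "\<lambda>x. \<lambda>j\<in>{..<n}. F j x"])
      fix x x' assume "x \<in> X" "x' \<in> X"
      have "(\<Sum>c\<in>?C. \<psi> (\<Sum>j<n. c j * F j x) * cnj (\<psi> (\<Sum>j<n. c j * F j x')))
          = (\<Sum>c\<in>?C. \<psi> (\<Sum>j<n. c j * (F j x - F j x')))"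
        by (simp add: cnj_eq add[symmetric] right_diff_distrib sum_subtractf)
      also have "\<dots> = (if \<forall>j<n. F j x - F j x' = 0 then of_nat (CARD('a) ^ n) else 0)"
        by (rule character_sum_vector)
      also have "(\<forall>j<n. F j x - F j x' = 0) \<longleftrightarrow> (\<lambda>j\<in>{..<n}. F j x) = (\<lambda>j\<in>{..<n}. F j x')"
        by (auto simp: fun_eq_iff restrict_def)
      finally show "(\<Sum>c\<in>?C. \<psi> (\<Sum>j<n. c j * F j x) * cnj (\<psi> (\<Sum>j<n. c j * F j x')))
        = (if (\<lambda>j\<in>{..<n}. F j x) = (\<lambda>j\<in>{..<n}. F j x') then of_nat (CARD('a) ^ n) else 0)" .
    next
      fix x assume "x \<in> X"
      have "{x' \<in> X. (\<lambda>j\<in>{..<n}. F j x') = (\<lambda>j\<in>{..<n}. F j x)} = {x' \<in> X. \<forall>j<n. F j x' = F j x}"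
        by (auto simp: fun_eq_iff restrict_def)
      then show "card {x' \<in> X. (\<lambda>j\<in>{..<n}. F j x') = (\<lambda>j\<in>{..<n}. F j x)} \<le> D"
        using X(2)[OF \<open>x \<in> X\<close>] by simp
    qed (rule X)
    finally show "(\<Sum>c\<in>?C - {?o}. (cmod (T c))\<^sup>2) \<le> real CARD('a) ^ n * real (card X) * real D" by simp
  next
    have "(cmod (P c))\<^sup>2 = (\<Prod>i\<in>K. (cmod (gauss_power_sum (d i) (?u c i)))\<^sup>2)" for c
      unfolding P_def by (simp add: prod_norm[symmetric] prod_power_distrib)
    moreover have "(\<Sum>c\<in>?C - {?o}. \<Prod>i\<in>K. (cmod (gauss_power_sum (d i) (?u c i)))\<^sup>2)
      \<le> 2 ^ m * ((2 * real d0 ^ 2 * real CARD('a)) ^ (m - n) * (real d0 * real CARD('a) ^ 2) ^ n)"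
    proof (rule sum_prod_linear_forms_le[OF K, where f = "\<lambda>i v. (cmod (gauss_power_sum (d i) v))\<^sup>2"])
      show "c j = 0" if "S \<subseteq> K" "card S = n" "\<And>i. i \<in> S \<Longrightarrow> ?u c i = 0" "j < n" for S c j
        using that by (rule inj)
    next
      fix i :: nat and v :: 'a assume i: "i \<in> K" and "v \<noteq> 0"
      have "(cmod (gauss_power_sum (d i) v))\<^sup>2 \<le> 2 * real (d i) ^ 2 * real CARD('a)"
        by (rule gauss_power_sum_bound[OF d(1)[OF i] \<open>v \<noteq> 0\<close>])
      also have "\<dots> \<le> 2 * real d0 ^ 2 * real CARD('a)"
        using d(2)[OF i] by (intro mult_right_mono mult_left_mono power_mono) auto
      finally show "(cmod (gauss_power_sum (d i) v))\<^sup>2 \<le> 2 * real d0 ^ 2 * real CARD('a)" .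
    next
      fix i assume i: "i \<in> K"
      have "(\<Sum>v\<in>UNIV. (cmod (gauss_power_sum (d i) v))\<^sup>2) \<le> real (d i) * real CARD('a) ^ 2"
        by (rule gauss_power_sum_second_moment[OF d(1)[OF i]])
      also have "\<dots> \<le> real d0 * real CARD('a) ^ 2"
        using d(2)[OF i] by (intro mult_right_mono) auto
      finally show "(\<Sum>v\<in>UNIV. (cmod (gauss_power_sum (d i) v))\<^sup>2) \<le> real d0 * real CARD('a) ^ 2" .
    qed auto
    ultimately show "(\<Sum>c\<in>?C - {?o}. (cmod (P c))\<^sup>2)
      \<le> 2 ^ m * ((2 * real d0 ^ 2 * real CARD('a)) ^ (m - n) * (real d0 * real CARD('a) ^ 2) ^ n)"
      by simp
  next
    show "0 \<le> real CARD('a) ^ n * real (card X) * real D" by simp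
    show "0 \<le> (\<Sum>c\<in>?C - {?o}. (cmod (P c))\<^sup>2)" by (intro sum_nonneg zero_le_power2)
  qed
  finally show ?thesis .
qed

end

section \<open>Application to the given system\<close>

lemma mp_eval_cong:
  assumes "mp_vars_below k p" "\<And>i. i < k \<Longrightarrow> x i = y i"
  shows "mp_eval p x = mp_eval p y"
  unfolding mp_eval_def
proof (intro sum.cong arg_cong2[where f = "(*)"] prod.cong refl)
  fix m i assume "m \<in> Poly_Mapping.keys p" "i \<in> Poly_Mapping.keys m"
  then have "i < k" using assms(1) unfolding mp_vars_below_def by force
  then show "x i ^ Poly_Mapping.lookup m i = y i ^ Poly_Mapping.lookup m i" using assms(2) by simp
qed

text \<open>Since \<open>k \<le> n\<close>, the first \<open>n\<close> columns are invertible and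
  cover the first \<open>k\<close> variables. A combination of the fibre equations therefore
  isolates each \<open>x i ^ d i\<close> and equates it with a function of degree below
  \<open>d i\<close>.\<close>

lemma card_fibre_le_prod_degrees:
  fixes a :: "nat \<Rightarrow> nat \<Rightarrow> 'a::{finite,field}"
  assumes "k \<le> n"
    and inj: "\<And>c j. (\<And>i. i < n \<Longrightarrow> (\<Sum>j<n. c j * a j i) = 0) \<Longrightarrow> j < n \<Longrightarrow> c j = 0"
    and g: "\<And>j. j < n \<Longrightarrow> mp_vars_below k (g j)" "\<And>i j. i < k \<Longrightarrow> j < n \<Longrightarrow> mp_totdeg (g j) < d i"
  shows "card {x \<in> PiE {..<k} (\<lambda>_. UNIV). \<forall>j<n. (\<Sum>i<k. a j i * x i ^ d i) - mp_eval (g j) x = v j}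
           \<le> (\<Prod>i<k. d i)"
proof (rule card_le_prod_degrees)
  let ?Z = "{x \<in> PiE {..<k} (\<lambda>_. UNIV). \<forall>j<n. (\<Sum>i<k. a j i * x i ^ d i) - mp_eval (g j) x = v j}"
  fix i assume i: "i < k"
  have bij: "bij_betw (\<lambda>c. \<lambda>i\<in>{..<n}. \<Sum>j<n. c j * a j i) (PiE {..<n} (\<lambda>_. UNIV)) (PiE {..<n} (\<lambda>_. UNIV))"
  proof (rule bij_betw_linear_forms)
    show "c j = 0" if "\<And>i. i \<in> {..<n} \<Longrightarrow> (\<Sum>j<n. c j * a j i) = 0" "j < n" for c j
      by (rule inj[OF _ that(2)], rule that(1)) simp
  qed simp_all
  \<comment> \<open>The preimage \<open>b\<close> of the \<open>i\<close>-th unit vector supplies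
    the combination that isolates variable \<open>i\<close>.\<close>
  have "(\<lambda>l\<in>{..<n}. if l = i then 1 else 0)
      \<in> (\<lambda>c. \<lambda>l\<in>{..<n}. \<Sum>j<n. c j * a j l) ` PiE {..<n} (\<lambda>_. UNIV)"
    unfolding bij_betw_imp_surj_on[OF bij] by simp
  then obtain b where b: "(\<lambda>l\<in>{..<n}. if l = i then 1 else (0 :: 'a)) = (\<lambda>l\<in>{..<n}. \<Sum>j<n. b j * a j l)"
    by (rule imageE) (erule that)
  have b: "(\<Sum>j<n. b j * a j l) = (if l = i then 1 else 0)" if "l < k" for l
    using fun_cong[OF b[symmetric], of l] that \<open>k \<le> n\<close> by simp
  show "\<exists>f\<in>poly_funs_below k (d i). \<forall>x\<in>?Z. x i ^ d i = f x"
  proof (intro bexI ballI)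
    show "(\<lambda>x. \<Sum>j<n. b j * (v j + mp_eval (g j) x)) \<in> poly_funs_below k (d i)"
    proof (intro poly_funs_below_sum poly_funs_below.scale poly_funs_below.add)
      fix j assume "j \<in> {..<n}"
      then have deg: "mp_totdeg (g j) < d i" and "mp_vars_below k (g j)" using g i by auto
      then show "mp_eval (g j) \<in> poly_funs_below k (d i)" by (intro mp_eval_in_poly_funs_below)
      show "(\<lambda>_. v j) \<in> poly_funs_below k (d i)" using deg by (intro poly_funs_below_const) simp
    qed
  next
    fix x assume "x \<in> ?Z"
    then have "(\<Sum>j<n. b j * (v j + mp_eval (g j) x)) = (\<Sum>j<n. b j * (\<Sum>l<k. a j l * x l ^ d l))"
      by (intro sum.cong refl arg_cong2[where f = "(*)"]) (auto simp: algebra_simps)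
    also have "\<dots> = (\<Sum>j<n. \<Sum>l<k. b j * a j l * x l ^ d l)"
      by (simp only: sum_distrib_left mult.assoc)
    also have "\<dots> = (\<Sum>l<k. \<Sum>j<n. b j * a j l * x l ^ d l)"
      by (rule sum.swap)
    also have "\<dots> = (\<Sum>l<k. (\<Sum>j<n. b j * a j l) * x l ^ d l)"
      by (simp only: sum_distrib_right)
    also have "\<dots> = (\<Sum>l<k. if l = i then x i ^ d i else 0)"
      by (intro sum.cong refl) (auto simp: b)
    also have "\<dots> = x i ^ d i" using i by simp
    finally show "x i ^ d i = (\<Sum>j<n. b j * (v j + mp_eval (g j) x))" by simp
  qed
qed auto

theorem mainTheorem10:
  fixes a :: "nat \<Rightarrow> nat \<Rightarrow> 'a::{finite,field}"
    and d :: "nat \<Rightarrow> nat"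
    and g :: "nat \<Rightarrow> 'a mpoly_rep"
    and t n k :: nat
  assumes t_pos: "1 \<le> t"
    and k_bounds: "1 \<le> k" "k \<le> n"
    and d_decr: "\<And>i j. i < j \<Longrightarrow> j < t \<Longrightarrow> d j < d i"
    and d_ge2: "d (t - 1) \<ge> 2"
    and d_char: "\<And>i. i < t \<Longrightarrow> of_nat (d i) \<noteq> (0::'a)"
    and H: "\<And>S. S \<subseteq> {0..<t} \<Longrightarrow> card S = n \<Longrightarrow>
             vec_space.rank n (submatrix (mat n t (\<lambda>(j, i). a j i)) {0..<n} S) = n"
    and g_vars: "\<And>j. j < n \<Longrightarrow> mp_vars_below k (g j)"
    and g_cases: "(\<forall>j < n. mp_totdeg (g j) = 0)
                  \<or> ((\<forall>j < n. mp_totdeg (g j) < d (t - 1)) \<and> (\<exists>j < n. 0 < mp_totdeg (g j)))"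
    and n_small: "real n \<le> (real t - 1) / 2"
    and q_large: "real (card (UNIV :: 'a set)) > (6 * real n * real (d 0)) powr ((2 * real t + 2) / (real t - 2 * real n))"
  shows "\<exists>x :: nat \<Rightarrow> 'a. \<forall>j < n. (\<Sum>i < t. a j i * x i ^ d i) = mp_eval (g j) x"
proof (rule ccontr)
  assume no_sol: "\<not> ?thesis"
  obtain \<psi> :: "'a \<Rightarrow> complex" where "nontrivial_additive_character \<psi>"
    using nontrivial_additive_character_exists .
  then interpret nontrivial_additive_character \<psi> .
  have "real (2 * n + 1) \<le> real t" using n_small by simp
  then have tn: "2 * n + 1 \<le> t" by (simp only: of_nat_le_iff)
  \<comment> \<open>The number of variables that do not occur in the \<open>g j\<close>.\<close>
  define m where "m = t - k"
  define q where "q = real CARD('a)"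
  define d0 where "d0 = real (d 0)"
  let ?X = "PiE {..<k} (\<lambda>_. UNIV :: 'a set)"
  let ?F = "\<lambda>j x. (\<Sum>i<k. a j i * x i ^ d i) - mp_eval (g j) x"
  have inj: "c j = 0"
    if "S \<subseteq> {0..<t}" "card S = n" "\<And>i. i \<in> S \<Longrightarrow> (\<Sum>j<n. c j * a j i) = 0" "j < n" for S c j
    by (rule columns_combination_eq_0[OF that(1,2) H[OF that(1,2)] that(3,4)])
  have d_last: "d (t - 1) \<le> d i" if "i < t" for i
  proof (cases "i = t - 1")
    case False
    with that have "i < t - 1" by linarith
    then have "d (t - 1) < d i" by (rule d_decr) (use that in linarith)
    then show ?thesis by simp
  qed simp
  have d_first: "d i \<le> d 0" if "i < t" for i
    using d_decr[of 0 i] that by (cases "i = 0") auto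
  have deg: "mp_totdeg (g j) < d i" if "i < t" "j < n" for i j
  proof -
    \<comment> \<open>In the constant case the degree 0 is below \<open>d (t - 1) \<ge> 2\<close>,
      so both cases continue together.\<close>
    have "mp_totdeg (g j) < d (t - 1)" using g_cases d_ge2 that by fastforce
    with d_last[OF that(1)] show ?thesis by simp
  qed
  have fibre: "card {x' \<in> ?X. \<forall>j<n. ?F j x' = ?F j x} \<le> d 0 ^ k" for x
  proof -
    have "card {x' \<in> ?X. \<forall>j<n. ?F j x' = ?F j x} \<le> (\<Prod>i<k. d i)"
    proof (rule card_fibre_le_prod_degrees[OF k_bounds(2)])
      show "c j = 0" if "\<And>i. i < n \<Longrightarrow> (\<Sum>j<n. c j * a j i) = 0" "j < n" for c j
        by (rule inj[of "{0..<n}"]) (use that tn in auto)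
    qed (use deg g_vars tn k_bounds in auto)
    also have "\<dots> \<le> (\<Prod>i<k. d 0)"
      using d_first tn k_bounds by (intro prod_mono) auto
    finally show ?thesis by simp
  qed
  have "(real (card ?X) * real CARD('a) ^ m)\<^sup>2 \<le> (real CARD('a) ^ n * real (card ?X) * real (d 0 ^ k))
    * (2 ^ m * ((2 * real (d 0) ^ 2 * real CARD('a)) ^ (m - n) * (real (d 0) * real CARD('a) ^ 2) ^ n))"
  proof (rule no_solution_inequality[where K = "{k..<t}" and d = d and F = ?F and a = a])
    show "c j = 0" if "S \<subseteq> {k..<t}" "card S = n" "\<And>i. i \<in> S \<Longrightarrow> (\<Sum>j<n. c j * a j i) = 0" "j < n" for S c j
      by (rule inj[of S]) (use that in auto)
  next
    fix x y assume "x \<in> ?X" "y \<in> PiE {k..<t} (\<lambda>_. UNIV :: 'a set)"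
    define z where "z i = (if i < k then x i else y i)" for i
    obtain j where j: "j < n" "(\<Sum>i<t. a j i * z i ^ d i) \<noteq> mp_eval (g j) z"
      using no_sol by blast
    have "mp_eval (g j) z = mp_eval (g j) x"
      by (rule mp_eval_cong[OF g_vars[OF j(1)]]) (simp add: z_def)
    moreover have "(\<Sum>i<t. a j i * z i ^ d i) = (\<Sum>i<k. a j i * z i ^ d i) + (\<Sum>i=k..<t. a j i * z i ^ d i)"
      using sum.atLeastLessThan_concat[of 0 k t "\<lambda>i. a j i * z i ^ d i"] tn k_bounds
      by (simp add: lessThan_atLeast0)
    moreover have "(\<Sum>i<k. a j i * z i ^ d i) = (\<Sum>i<k. a j i * x i ^ d i)"
      by (intro sum.cong) (auto simp: z_def)
    moreover have "(\<Sum>i=k..<t. a j i * z i ^ d i) = (\<Sum>i=k..<t. a j i * y i ^ d i)"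
      by (intro sum.cong) (auto simp: z_def)
    ultimately show "\<exists>j<n. ?F j x + (\<Sum>i\<in>{k..<t}. a j i * y i ^ d i) \<noteq> 0"
      using j by (intro exI[of _ j]) (auto simp: algebra_simps)
  next
    fix i assume "i \<in> {k..<t}"
    then show "0 < d i" "d i \<le> d 0" using d_last[of i] d_first[of i] d_ge2 by auto
  qed (use tn k_bounds fibre in \<open>auto simp: m_def intro!: finite_PiE\<close>)
  then have "(q ^ k * q ^ m)\<^sup>2 \<le> (q ^ n * q ^ k * d0 ^ k)
    * (2 ^ m * ((2 * d0 ^ 2 * q) ^ (m - n) * (d0 * q ^ 2) ^ n))"
    by (simp add: card_PiE q_def d0_def)
  \<comment> \<open>Possible because \<open>k \<le> n\<close> and \<open>2 * n < t\<close>;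
    \<open>r\<close> is the exponent \<open>m - n\<close> in the inequality.\<close>
  moreover obtain r where r: "m = n + r"
    using tn k_bounds by (metis m_def add_leD1 diff_le_mono2 le_add_diff_inverse le_diff_conv2 le_trans mult_2)
  ultimately have "q ^ (k + k + n + n + r + r)
      \<le> q ^ (n + n + n + k + r) * (2 ^ (n + r + r) * d0 ^ (k + r + r + n))"
    by (simp add: power_mult_distrib power_add mult_ac power2_eq_square)
  then have ineq: "q ^ (2 * k + 2 * n + 2 * r) \<le> q ^ (3 * n + k + r) * (2 ^ (n + 2 * r) * d0 ^ (k + 2 * r + n))"
    by (simp add: numeral_eq_Suc add_ac)
  have "0 < q" by (simp add: q_def)
  have d0: "2 \<le> d0" using d_ge2 d_last[of 0] t_pos by (simp add: d0_def)
  have n1: "1 \<le> real n" using k_bounds by simp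
  have t_eq: "t = k + n + r" using r tn k_bounds by (simp add: m_def)
  \<comment> \<open>The exponent of \<open>q\<close> on the left exceeds that on the right by
    \<open>t - 2 * n\<close>, which is what remains after cancellation.\<close>
  then have "2 * k + 2 * n + 2 * r = (3 * n + k + r) + (t - 2 * n)" using tn by simp
  with ineq have "q ^ (3 * n + k + r) * q ^ (t - 2 * n)
      \<le> q ^ (3 * n + k + r) * (2 ^ (n + 2 * r) * d0 ^ (k + 2 * r + n))"
    by (simp only: power_add)
  then have "q ^ (t - 2 * n) \<le> 2 ^ (n + 2 * r) * d0 ^ (k + 2 * r + n)"
    using \<open>0 < q\<close> by (simp only: mult_le_cancel_left_pos zero_less_power)
  \<comment> \<open>Both exponents are at most \<open>2 * t + 2\<close>, because
    \<open>t = k + n + r\<close>.\<close>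
  also have "\<dots> \<le> 2 ^ (2 * t + 2) * d0 ^ (2 * t + 2)"
    using d0 t_eq k_bounds by (intro mult_mono power_increasing) auto
  also have "\<dots> = (2 * d0) ^ (2 * t + 2)" by (rule power_mult_distrib[symmetric])
  also have "\<dots> \<le> (6 * real n * d0) ^ (2 * t + 2)"
    using d0 n1 by (intro power_mono mult_right_mono) auto
  also have "\<dots> < q ^ (t - 2 * n)"
  proof -
    let ?E = "6 * real n * d0" and ?s = "real t - 2 * real n"
    have s: "0 < ?s" "?s = real (t - 2 * n)" using tn by auto
    have E: "0 < ?E" using d0 n1 by simp
    have "?E powr ((2 * real t + 2) / ?s) < q"
      using q_large unfolding q_def d0_def .
    \<comment> \<open>Raising the assumed bound on \<open>q\<close> to the positive power
      \<open>t - 2 * n\<close> clears the denominator of its exponent.\<close>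
    then have "(?E powr ((2 * real t + 2) / ?s)) powr ?s < q powr ?s"
      using s(1) by (intro powr_less_mono2) auto
    also have "(?E powr ((2 * real t + 2) / ?s)) powr ?s = ?E powr real (2 * t + 2)"
      using s(1) by (simp add: powr_powr add.commute)
    also have "\<dots> = ?E ^ (2 * t + 2)" using E by (rule powr_realpow)
    also have "q powr ?s = q ^ (t - 2 * n)"
      unfolding s(2) using \<open>0 < q\<close> by (rule powr_realpow)
    finally show ?thesis .
  qed
  finally show False by simp
qed

end
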